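(* Let $n,k,m$ be positive integers. The total number of parts equal to $k$ over all compositions of $n$ is equal to the total number of parts equal to $k+m$ over all compositions of $n+m$.
   Context: A composition of $n$ is an ordered list of positive integers (its parts) whose sum is $n$. The total number of parts equal to $k$ in compositions of $n$ is the sum, over all compositions of $n$, of the number of parts equal to $k$, counted with multiplicity. *)

theory Defs
  imports Main
begin

definition compositions :: "nat \<Rightarrow> nat list set" where
  "compositions n = {xs. (\<forall>x\<in>set xs. 0 < x) \<and> sum_list xs = n}"

definition total_parts :: "nat \<Rightarrow> nat \<Rightarrow> nat" where
  "total_parts n k = (\<Sum>xs\<in>compositions n. count_list xs k)"

(* The sum in total_parts is a genuine sum, not the default value 0 for infinite index sets. *)
lemma finite_compositions: "finite (compositions n)"
proof -
  have len: "length xs \<le> sum_list xs" if "\<forall>x\<in>set xs. 0 < x" for xs :: "nat list"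
    using that by (induction xs) auto
  have "compositions n \<subseteq> {xs. set xs \<subseteq> {..n} \<and> length xs \<le> n}"
    using len by (auto simp: compositions_def intro: member_le_sum_list)
  then show ?thesis
    by (rule finite_subset) (rule finite_lists_length_le, simp)
qed

end

theory Submission
  imports Defs
begin

text \<open>
  Marking one part equal to \<open>k\<close> in a composition of \<open>n\<close> cuts it into the parts before the mark
  and the parts after it. These two lists of positive integers are arbitrary up to the condition
  that their sums and \<open>k\<close> add up to \<open>n\<close>, and the marked composition can be rebuilt from them.
  So \<open>total_parts n k\<close> counts such pairs of lists
  (lemma \<open>total_parts_eq_card_surroundings\<close>). The condition on the pair only involves the
  difference of \<open>n\<close> and \<open>k\<close>, which does not change when \<open>m\<close> is added to both: bijectively, the
  marked part grows from \<open>k\<close> to \<open>k + m\<close> and everything else stays in place.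
\<close>

definition splits_at :: "'a \<Rightarrow> 'a list \<Rightarrow> ('a list \<times> 'a list) set" where
  "splits_at k xs = {(ys, zs). xs = ys @ k # zs}"

definition surroundings :: "nat \<Rightarrow> nat \<Rightarrow> (nat list \<times> nat list) set" where
  "surroundings n k = {(ys, zs). (\<forall>x\<in>set ys \<union> set zs. 0 < x) \<and> sum_list ys + sum_list zs + k = n}"

lemma splits_at_Nil: "splits_at k [] = {}"
  by (simp add: splits_at_def)

text \<open>The marked occurrence is either the head or lies in the tail.\<close>

lemma splits_at_Cons:
  "splits_at k (x # xs) =
     (if x = k then {([], xs)} else {}) \<union> (\<lambda>(ys, zs). (x # ys, zs)) ` splits_at k xs"
  by (auto simp: splits_at_def Cons_eq_append_conv image_iff)

lemma finite_splits_at: "finite (splits_at k xs)"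
  by (induction xs) (simp_all add: splits_at_Nil splits_at_Cons)

lemma card_splits_at: "card (splits_at k xs) = count_list xs k"
proof (induction xs)
  case Nil
  then show ?case by (simp add: splits_at_Nil)
next
  case (Cons x xs)
  let ?push = "\<lambda>(ys, zs). (x # ys, zs)"
  have "card (?push ` splits_at k xs) = count_list xs k"
    using Cons.IH by (subst card_image) (auto simp: inj_on_def)
  moreover have "([], xs) \<notin> ?push ` splits_at k xs"
    by auto
  ultimately show ?case
    by (cases "x = k") (simp_all add: splits_at_Cons finite_splits_at card_insert_disjoint)
qed

text \<open>
  Positivity of \<open>k\<close> is what makes every pair of surroundings come from a composition: the
  inserted \<open>k\<close> has to be a legitimate part.
\<close>

lemma UN_splits_at_compositions:
  assumes "0 < k"
  shows "(\<Union>xs\<in>compositions n. splits_at k xs) = surroundings n k"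
  using assms by (auto simp: splits_at_def surroundings_def compositions_def)

lemma total_parts_eq_card_surroundings:
  assumes "0 < k"
  shows "total_parts n k = card (surroundings n k)"
proof -
  have "total_parts n k = (\<Sum>xs\<in>compositions n. card (splits_at k xs))"
    by (simp add: total_parts_def card_splits_at)
  also have "\<dots> = card (\<Union>xs\<in>compositions n. splits_at k xs)"
    \<comment> \<open>A split determines the list it came from, so the union is disjoint.\<close>
    by (rule card_UN_disjoint[symmetric])
       (auto simp: finite_compositions finite_splits_at, auto simp: splits_at_def)
  finally show ?thesis
    by (simp add: UN_splits_at_compositions[OF assms])
qed

theorem proposition2p10:
  fixes n k m :: nat
  assumes "0 < n" and "0 < k" and "0 < m"
  shows "total_parts n k = total_parts (n + m) (k + m)"
proof -
  have "surroundings n k = surroundings (n + m) (k + m)"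
    by (auto simp: surroundings_def)
  then show ?thesis
    using assms by (simp add: total_parts_eq_card_surroundings)
qed

end
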